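(* For every integer $n\geq 0$, $$|L_n(1)|\leq 1,$$ which is equivalent to $$|Q_n(1)| \leq n!$$ for every integer $n\geq 0$.
   Context: For an integer $n\ge 0$, $L_n$ denotes the classical Laguerre polynomial $$L_n(x) = \frac{1}{n!} e^x \left(\frac{d}{dx}\right)^n (e^{-x}x^n) = \sum_{k=0}^{n} \frac{1}{k!} \binom{n}{k} (-x)^{k},$$ and $Q_n$ denotes the polynomial $$Q_n(x)= \sum_{k=0}^{n} k! \binom{n}{k}^2 (-x)^{k}.$$ *)

theory Defs
  imports "HOL-Analysis.Analysis" "HOL-Computational_Algebra.Polynomial"
begin

text \<open>In both definitions \<open>[:0, -1:]\<close> is the polynomial \<open>-x\<close>.\<close>

definition laguerre :: "nat \<Rightarrow> real poly" where
  "laguerre n = (\<Sum>k=0..n. smult (1 / fact k * real (n choose k)) ([:0, -1:] ^ k))"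

definition Q_poly :: "nat \<Rightarrow> real poly" where
  "Q_poly n = (\<Sum>k=0..n. smult (fact k * (real (n choose k))\<^sup>2) ([:0, -1:] ^ k))"

lemma poly_laguerre:
  "poly (laguerre n) x = (\<Sum>k=0..n. 1 / fact k * real (n choose k) * (- x) ^ k)"
  by (simp add: laguerre_def poly_sum)

lemma poly_Q_poly:
  "poly (Q_poly n) x = (\<Sum>k=0..n. fact k * (real (n choose k))\<^sup>2 * (- x) ^ k)"
  by (simp add: Q_poly_def poly_sum)

text \<open>The explicit sum agrees with Rodrigues' formula. Up to the factor \<open>e\<^sup>-\<^sup>t\<close>,
  differentiating \<open>e\<^sup>-\<^sup>t p(t)\<close> sends the polynomial \<open>p\<close> to \<open>p' - p\<close>.\<close>

lemma funpow_deriv_exp_poly: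
  fixes p :: "real poly"
  shows "(deriv ^^ m) (\<lambda>t. exp (- t) * poly p t)
       = (\<lambda>t. exp (- t) * poly (((\<lambda>q. pderiv q - q) ^^ m) p) t)"
proof (induction m)
  case (Suc m)
  have "deriv (\<lambda>t. exp (- t) * poly q t) = (\<lambda>t. exp (- t) * poly (pderiv q - q) t)"
    for q :: "real poly"
    by (rule ext, rule DERIV_imp_deriv)
       (auto intro!: derivative_eq_intros simp: algebra_simps)
  then show ?case by (simp add: Suc)
qed simp

lemma coeff_funpow_pderiv_minus_monom:
  "coeff (((\<lambda>q. pderiv q - q) ^^ m) (monom (1::real) n)) i
     = (if i \<le> n then fact n / fact i * (- 1) ^ (m + n + i) * real (m choose (n - i)) else 0)"
proof (induction m arbitrary: i)
  case 0
  then show ?case by (auto simp: binomial_eq_0)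
next
  case (Suc m)
  have step: "coeff (((\<lambda>q. pderiv q - q) ^^ Suc m) (monom (1::real) n)) i =
      real (Suc i) * coeff (((\<lambda>q. pderiv q - q) ^^ m) (monom (1::real) n)) (Suc i)
        - coeff (((\<lambda>q. pderiv q - q) ^^ m) (monom (1::real) n)) i"
    by (simp add: coeff_pderiv)
  consider "i > n" | "i = n" | d where "n = Suc (i + d)"
    by (metis less_imp_Suc_add nat_neq_iff)
  then show ?case
  proof cases
    case 3
    then have d: "n - i = Suc d" "n - Suc i = d" "i \<le> n" "Suc i \<le> n" by auto
    have "real (Suc i) * (fact n / fact (Suc i) * s * c) = fact n / fact i * s * c" for s c :: real
      by (simp add: divide_simps del: of_nat_Suc)
    then show ?thesis
      unfolding step Suc using d
      by (simp del: of_nat_Suc fact_Suc) (simp add: ring_distribs add_divide_distrib)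
  qed (simp_all add: step Suc coeff_pderiv)
qed

lemma laguerre_rodrigues:
  "poly (laguerre n) x = 1 / fact n * exp x * (deriv ^^ n) (\<lambda>t. exp (- t) * t ^ n) x"
proof -
  let ?D = "((\<lambda>q. pderiv q - q) ^^ n) (monom (1::real) n)"
  have D: "?D = (\<Sum>k=0..n. monom (fact n / fact k * (- 1) ^ k * real (n choose k)) k)"
    by (rule poly_eqI)
       (auto simp: coeff_funpow_pderiv_minus_monom coeff_sum binomial_symmetric[symmetric]
             power_add simp flip: power_mult_distrib)
  have "(deriv ^^ n) (\<lambda>t. exp (- t) * t ^ n) x = exp (- x) * poly ?D x"
    using funpow_deriv_exp_poly[of n "monom 1 n"] by (simp add: poly_monom)
  also have "1 / fact n * exp x * (exp (- x) * poly ?D x) = poly ?D x / fact n"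
    by (simp add: exp_minus)
  also have "\<dots> = poly (laguerre n) x"
    unfolding D poly_laguerre poly_sum sum_divide_distrib
    by (rule sum.cong) (simp_all add: poly_monom power_minus[of x])
  finally show ?thesis by simp
qed

end

theory Submission
  imports Defs
begin

text \<open>
  At \<open>x = 1\<close> the pair \<open>l = L\<^sub>n(1)\<close>, \<open>d = L\<^sub>n'(1)\<close> evolves by a shear in each coordinate:
  \<open>d\<close> becomes \<open>d' = d - l\<close>, and then \<open>l\<close> becomes \<open>l' = l + h d'\<close> with \<open>h = 1/(n+1)\<close>. This is
  a discrete oscillator whose stiffness \<open>h\<close> slowly decreases, and like every linear map of
  the plane with determinant 1 the step preserves a quadratic form, here the energy
  \<open>l\<^sup>2 - h l d + h d\<^sup>2\<close>. It dominates \<open>(1 - h/4) l\<^sup>2\<close>, so a bound on the energy bounds \<open>l\<close>.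

  The preserved form depends on \<open>h\<close>, so replacing \<open>h\<close> by the next value \<open>h'\<close> changes the
  energy by \<open>-(h - h') (d'\<^sup>2 - l' d')\<close>. This is a loss unless \<open>d'\<close> lies between \<open>0\<close> and
  \<open>l'\<close>, and it is never a gain of more than \<open>(h - h') l'\<^sup>2 / 4\<close>. As long as \<open>\<bar>l'\<bar> \<le> 1\<close>
  the gains telescope and total at most \<open>1/8\<close> from \<open>n = 1\<close> on, where the energy is only \<open>1/2\<close> because \<open>L\<^sub>1(1) = 0\<close>. So the energy
  stays below \<open>5/8\<close>, which forces \<open>l\<^sup>2 \<le> (5/8) / (7/8) < 1\<close> and closes the induction: since the
  step itself preserves the energy for \<open>h\<close>, the bound on \<open>l'\<close> is available before \<open>h\<close> changes.

  The statement about \<open>Q\<^sub>n\<close> is the same one, since reversing the order of the coefficients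
  turns \<open>Q\<^sub>n\<close> into \<open>n! L\<^sub>n\<close> up to sign.
\<close>

lemma coeff_laguerre:
  "coeff (laguerre n) k = (- 1) ^ k / fact k * real (n choose k)"
proof -
  have pow: "[:0, -1:] ^ j = monom ((- 1) ^ j) j" for j :: nat
    by (metis monom_0 monom_Suc monom_power mult_1 One_nat_def)
  have "coeff (laguerre n) k
      = (\<Sum>j=0..n. if j = k then 1 / fact j * real (n choose j) * (- 1) ^ j else 0)"
    unfolding laguerre_def coeff_sum by (intro sum.cong) (simp_all add: pow)
  also have "\<dots> = (- 1) ^ k / fact k * real (n choose k)"
    by (auto simp: binomial_eq_0)
  finally show ?thesis .
qed

lemma pderiv_laguerre_Suc:
  "pderiv (laguerre (Suc n)) = pderiv (laguerre n) - laguerre n"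
proof (rule poly_eqI)
  fix k
  have "real (Suc k) * ((- 1) ^ Suc k / fact (Suc k) * c) = - ((- 1) ^ k / fact k * c)" for c :: real
    by (simp add: divide_simps del: of_nat_Suc)
  then show "coeff (pderiv (laguerre (Suc n))) k = coeff (pderiv (laguerre n) - laguerre n) k"
    unfolding coeff_diff coeff_pderiv coeff_laguerre
    by (simp add: ring_distribs del: of_nat_Suc fact_Suc power_Suc)
qed

text \<open>Coefficientwise this is the absorption identity \<open>(n+1) C(n,k) = (k+1) C(n+1,k+1)\<close>,
  Pascal's rule having reduced the difference on the left to \<open>C(n,k)\<close>.\<close>

lemma laguerre_Suc_diff:
  "smult (real (Suc n)) (laguerre (Suc n) - laguerre n) = pCons 0 (pderiv (laguerre (Suc n)))"
proof (rule poly_eqI)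
  fix k
  show "coeff (smult (real (Suc n)) (laguerre (Suc n) - laguerre n)) k
      = coeff (pCons 0 (pderiv (laguerre (Suc n)))) k"
  proof (cases k)
    case 0
    then show ?thesis by (simp add: coeff_laguerre)
  next
    case (Suc j)
    have absorb: "real (Suc n) * real (n choose j) = real (Suc j) * real (Suc n choose Suc j)"
      by (metis Suc_times_binomial of_nat_mult)
    have "coeff (smult (real (Suc n)) (laguerre (Suc n) - laguerre n)) k
        = (- 1) ^ Suc j / fact (Suc j) * (real (Suc n) * real (n choose j))"
      unfolding Suc coeff_smult coeff_diff coeff_laguerre
      by (simp add: ring_distribs del: of_nat_Suc fact_Suc power_Suc)
    also have "\<dots> = coeff (pCons 0 (pderiv (laguerre (Suc n)))) k"
      unfolding absorb Suc coeff_pCons_Suc coeff_pderiv coeff_laguerre by (simp only: mult_ac)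
    finally show ?thesis .
  qed
qed

definition energy :: "real \<Rightarrow> real \<Rightarrow> real \<Rightarrow> real" where
  "energy h l d = l\<^sup>2 - h * (l * d) + h * d\<^sup>2"

lemma energy_step:
  assumes "d' = d - l" "l' = l + h * d'"
  shows "energy h l' d' = energy h l d"
  unfolding energy_def assms by (simp add: algebra_simps power2_eq_square)

lemma energy_lower_bound:
  assumes "0 \<le> h"
  shows "(1 - h / 4) * l\<^sup>2 \<le> energy h l d"
proof -
  have "energy h l d = (1 - h / 4) * l\<^sup>2 + h * (d - l / 2)\<^sup>2"
    unfolding energy_def by (simp add: algebra_simps power2_eq_square)
  then show ?thesis using assms by simp
qed

lemma energy_change_stiffness:
  assumes "h' \<le> h"
  shows "energy h' l d \<le> energy h l d + (h - h') / 4 * l\<^sup>2"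
proof -
  have "energy h l d + (h - h') / 4 * l\<^sup>2 = energy h' l d + (h - h') * (d - l / 2)\<^sup>2"
    unfolding energy_def by (simp add: algebra_simps power2_eq_square)
  then show ?thesis using assms by simp
qed

lemma square_le_1_if_energy_le:
  assumes "0 \<le> h" "h \<le> 1 / 2" "energy h l d \<le> 5 / 8"
  shows "l\<^sup>2 \<le> 1"
proof -
  have "7 / 8 * l\<^sup>2 \<le> (1 - h / 4) * l\<^sup>2"
    using assms by (intro mult_right_mono) auto
  then show ?thesis
    using energy_lower_bound[OF assms(1), of l d] assms(3) by linarith
qed

text \<open>The index \<open>n = m + 1\<close> starts at 1 because the energy \<open>1\<close> at \<open>n = 0\<close> is too large.
  The term \<open>-h/4\<close> is the part of the total gain \<open>1/8\<close> that the later steps have yet to use up: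
  \<open>h = 1/(n+1)\<close> is the sum of all later decreases of the stiffness.\<close>

lemma laguerre_energy_bound:
  fixes m :: nat
  defines "h \<equiv> \<lambda>m. 1 / real (m + 2)"
  shows "energy (h m) (poly (laguerre (Suc m)) 1) (poly (pderiv (laguerre (Suc m))) 1)
           \<le> 5 / 8 - h m / 4"
proof (induction m)
  case 0
  have "laguerre 0 = 1" by (simp add: laguerre_def)
  then have "poly (pderiv (laguerre (Suc 0))) 1 = -1"
    by (simp add: pderiv_laguerre_Suc)
  moreover have "poly (laguerre (Suc 0)) 1 = 0"
    by (simp add: poly_laguerre)
  ultimately show ?case by (simp add: energy_def h_def)
next
  case (Suc m)
  define l d l' d' where "l = poly (laguerre (Suc m)) 1"
    and "d = poly (pderiv (laguerre (Suc m))) 1"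
    and "l' = poly (laguerre (Suc (Suc m))) 1"
    and "d' = poly (pderiv (laguerre (Suc (Suc m)))) 1"
  have h: "0 \<le> h m" "h m \<le> 1 / 2" "h (Suc m) \<le> h m"
    by (auto simp: h_def field_simps)
  have d': "d' = d - l"
    by (simp add: d'_def d_def l_def pderiv_laguerre_Suc[of "Suc m"])
  have "real (Suc (Suc m)) * (l' - l) = d'"
    using arg_cong[OF laguerre_Suc_diff[of "Suc m"], of "\<lambda>p. poly p 1"]
    by (simp add: l'_def l_def d'_def del: of_nat_Suc)
  then have l': "l' = l + h m * d'"
    by (auto simp: h_def field_simps)
  have E: "energy (h m) l' d' \<le> 5 / 8 - h m / 4"
    using Suc energy_step[OF d' l'] by (simp add: l_def d_def)
  then have "l'\<^sup>2 \<le> 1"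
    using h by (intro square_le_1_if_energy_le[of "h m" l' d']) auto
  then have "(h m - h (Suc m)) / 4 * l'\<^sup>2 \<le> (h m - h (Suc m)) / 4"
    using h by (intro mult_left_le) auto
  then have "energy (h (Suc m)) l' d' \<le> 5 / 8 - h (Suc m) / 4"
    using energy_change_stiffness[OF h(3), of l' d'] E by argo
  then show ?case by (simp add: l'_def d'_def)
qed

lemma abs_laguerre_1_le_1: "\<bar>poly (laguerre n) 1\<bar> \<le> 1"
proof (cases n)
  case 0
  then show ?thesis by (simp add: poly_laguerre)
next
  case (Suc m)
  let ?h = "1 / real (m + 2)"
  have h: "0 \<le> ?h" "?h \<le> 1 / 2" by (auto simp: field_simps)
  have "energy ?h (poly (laguerre (Suc m)) 1) (poly (pderiv (laguerre (Suc m))) 1) \<le> 5 / 8"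
    using laguerre_energy_bound[of m] by (rule order_trans) simp
  then have "(poly (laguerre (Suc m)) 1)\<^sup>2 \<le> 1"
    using square_le_1_if_energy_le[OF h] by blast
  then show ?thesis by (simp add: Suc abs_square_le_1)
qed

lemma poly_Q_poly_eq_laguerre:
  assumes "x \<noteq> 0"
  shows "poly (Q_poly n) x = fact n * (- x) ^ n * poly (laguerre n) (1 / x)"
proof -
  have "poly (Q_poly n) x
      = (\<Sum>k=0..n. fact (n - k) * (real (n choose (n - k)))\<^sup>2 * (- x) ^ (n - k))"
    unfolding poly_Q_poly by (subst sum.atLeastAtMost_rev) simp
  also have "\<dots> = (\<Sum>k=0..n. fact n * (- x) ^ n * (1 / fact k * real (n choose k) * (- (1 / x)) ^ k))"
  proof (rule sum.cong)
    fix k assume "k \<in> {0..n}"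
    then have k: "k \<le> n" by simp
    have sym: "n choose (n - k) = n choose k"
      using k by (simp add: binomial_symmetric[symmetric])
    have "fact k * fact (n - k) * real (n choose k) = fact n"
      using binomial_fact_lemma[OF k] by (metis of_nat_fact of_nat_mult)
    then have binom: "fact (n - k) * real (n choose k) = fact n / fact k"
      by (simp add: field_simps)
    have "(- x) ^ n = (- x) ^ (n - k) * (- x) ^ k"
      using k by (simp flip: power_add)
    moreover have "(- x) ^ k * (- (1 / x)) ^ k = 1"
      using assms by (simp flip: power_mult_distrib)
    ultimately have pow: "(- x) ^ (n - k) = (- x) ^ n * (- (1 / x)) ^ k"
      by (simp add: mult.assoc)
    have "fact (n - k) * (real (n choose k))\<^sup>2 * (- x) ^ (n - k)
        = (fact (n - k) * real (n choose k)) * real (n choose k) * (- x) ^ (n - k)"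
      by (simp add: power2_eq_square)
    then show "fact (n - k) * (real (n choose (n - k)))\<^sup>2 * (- x) ^ (n - k)
        = fact n * (- x) ^ n * (1 / fact k * real (n choose k) * (- (1 / x)) ^ k)"
      unfolding sym binom pow by simp
  qed simp
  also have "\<dots> = fact n * (- x) ^ n * poly (laguerre n) (1 / x)"
    by (simp add: poly_laguerre sum_distrib_left)
  finally show ?thesis .
qed

lemma abs_Q_poly_1: "\<bar>poly (Q_poly n) 1\<bar> = fact n * \<bar>poly (laguerre n) 1\<bar>"
  by (simp add: poly_Q_poly_eq_laguerre abs_mult power_abs)

theorem corollary3:
  shows "(\<forall>n::nat. \<bar>poly (laguerre n) 1\<bar> \<le> 1) \<and>
         (\<forall>n::nat. \<bar>poly (Q_poly n) 1\<bar> \<le> fact n) \<and>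
         (\<forall>n::nat. \<bar>poly (laguerre n) 1\<bar> \<le> 1 \<longleftrightarrow> \<bar>poly (Q_poly n) 1\<bar> \<le> fact n)"
  by (simp add: abs_Q_poly_1 abs_laguerre_1_le_1)

end
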